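(* Let $R\subseteq\mathbb{R}$ and let $f^*\in C^4(\mathbb{R})$ be a bijection from $\mathbb{R}$ onto $R$. Let the two-point quadrature formula $\hat I_1[f]=h\,q_1(f(a),f(a+h))$ (nodes $0$ and $1$) be symmetric and affinely exact on $f^*$, where $q_1$ is three times continuously differentiable on $R\times R$. Define $$q_2(f_0,f_1,f_2)=\tfrac23\bigl(q_1(f_0,f_1)+q_1(f_1,f_2)\bigr)-\tfrac13q_1(f_0,f_2).$$ Then the three-point quadrature formula with nodes $\xi_0=0$, $\xi_1=\frac12$, $\xi_2=1$ given by $$\hat I_2[f]=h\,q_2\bigl(f(a),f(a+\tfrac h2),f(a+h)\bigr)$$ is symmetric and affinely exact on $f^*$, and has $o(h^4)$ errors: for every $f\in C^4(\mathbb{R})$ with values in $R$ and every $a\in\mathbb{R}$, $\bigl|\hat I_2[f]-\int_a^{a+h}f(x)\,dx\bigr|=o(h^4)$ as $h\to0^+$.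
   Context: For a quadrature formula $\hat I[f]=h\,q(f(a+\xi_0h),\ldots,f(a+\xi_{n-1}h))$ with $a\in\mathbb{R}$, $h>0$: - $\hat I$ is affinely exact on $f^*$ if, with $f^*_{\alpha,\beta}(x)=f^*(\alpha x+\beta)$, one has $\hat I[f^*_{\alpha,\beta}]=\int_a^{a+h}f^*_{\alpha,\beta}(x)\,dx$ for all $\alpha,\beta\in\mathbb{R}$ and all $h>0$. - $\hat I$ is symmetric if $\xi_{n-1-k}=1-\xi_k$ for all $k\in\{0,\ldots,n-1\}$ and $q(f_{n-1},\ldots,f_0)=q(f_0,\ldots,f_{n-1})$ for all arguments in the domain of $q$ (here $R^n$). *)

theory Defs
  imports "HOL-Analysis.Analysis" "HOL-Library.Landau_Symbols"
begin

(* Meant for open S, where differentiability at a point of S depends only on the values on S.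
   For 'a = real the derivative in direction v is v times the ordinary derivative. *)
primrec Ck_on :: "nat \<Rightarrow> 'a::euclidean_space set \<Rightarrow> ('a \<Rightarrow> real) \<Rightarrow> bool" where
  "Ck_on 0 S f \<longleftrightarrow> continuous_on S f"
| "Ck_on (Suc k) S f \<longleftrightarrow>
     (\<forall>x\<in>S. f differentiable (at x)) \<and>
     (\<forall>v. Ck_on k S (\<lambda>x. frechet_derivative f (at x) v))"

(* An n-point formula is given by the list xs of its n nodes and a function q, whose
   n real arguments are passed as a list; values of q on lists of other lengths are irrelevant. *)
definition quadrature ::
    "real list \<Rightarrow> (real list \<Rightarrow> real) \<Rightarrow> real \<Rightarrow> real \<Rightarrow> (real \<Rightarrow> real) \<Rightarrow> real" where
  "quadrature xs q a h f = h * q (map (\<lambda>\<xi>. f (a + \<xi> * h)) xs)"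

(* The base point a is universally quantified; as the affine maps include all translations,
   exactness for a single a is equivalent. *)
definition affinely_exact ::
    "real list \<Rightarrow> (real list \<Rightarrow> real) \<Rightarrow> (real \<Rightarrow> real) \<Rightarrow> bool" where
  "affinely_exact xs q fs \<longleftrightarrow>
     (\<forall>\<alpha> \<beta> a h. h > 0 \<longrightarrow>
        ((\<lambda>x. fs (\<alpha> * x + \<beta>)) has_integral quadrature xs q a h (\<lambda>x. fs (\<alpha> * x + \<beta>))) {a..a + h})"

definition symmetric_quadrature ::
    "real set \<Rightarrow> real list \<Rightarrow> (real list \<Rightarrow> real) \<Rightarrow> bool" where
  "symmetric_quadrature R xs q \<longleftrightarrow>
     (\<forall>k<length xs. xs ! (length xs - 1 - k) = 1 - xs ! k) \<and>
     (\<forall>ys. length ys = length xs \<and> set ys \<subseteq> R \<longrightarrow> q (rev ys) = q ys)"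

end

theory Submission
  imports Defs
begin

text \<open>
Since \<open>q\<^sub>2\<close> is the Richardson combination of \<open>q\<^sub>1\<close> on the two halves and on the whole of the
interval, it inherits symmetry, and it inherits exactness because integrals over the halves add
up to the integral over the whole, with weights \<open>2 \<cdot> 2/3 - 1/3 = 1\<close>.

For the error bound, put \<open>Q(x, y) = q\<^sub>1(f(a + x), f(a + y))\<close>. Three properties of \<open>Q\<close>
give the bound: it is \<open>C\<^sup>3\<close> on the whole plane, it is symmetric, and \<open>Q(t, t) = f(a + t)\<close>. The last one
holds because affine exactness with slope \<open>0\<close> gives \<open>q\<^sub>1(u, u) = u\<close>. By symmetry, the part of degree
\<open>k \<le> 3\<close> of the Taylor expansion of \<open>Q\<close> at the origin is a symmetric form \<open>p\<^sub>k(s, t) / k!\<close> in two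
variables (\<open>symmetric_dir_derivs\<close>). All four quantities in the error depend on \<open>Q\<close> along lines
through the origin: \<open>Q(0, h/2)\<close>, \<open>Q(h/2, h)\<close> and \<open>Q(0, h)\<close>, and the integral of \<open>f\<close> over
\<open>[a, a + h]\<close>, which is the integral of \<open>Q\<close> along the diagonal. Hence one-dimensional Taylor
expansions at a single point suffice, and the error vanishes up to \<open>o(h\<^sup>4)\<close> because
\<open>2/3 (p\<^sub>k(0, 1/2) + p\<^sub>k(1/2, 1)) - 1/3 p\<^sub>k(0, 1) = p\<^sub>k(1, 1) / (k + 1)\<close> for \<open>k \<le> 3\<close>. This
identity holds for each symmetric form of degree at most \<open>3\<close>; it is what \<open>richardson_error\<close>
checks.
\<close>

section \<open>Calculus of continuously differentiable functions\<close>

lemma Ck_on_cong: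
  assumes "open S" "\<And>x. x \<in> S \<Longrightarrow> f x = g x" "Ck_on k S f"
  shows "Ck_on k S g"
  using assms
proof (induction k arbitrary: f g)
  case 0
  then show ?case by (simp cong: continuous_on_cong)
next
  case (Suc k)
  have der: "(g has_derivative frechet_derivative f (at x)) (at x)" if x: "x \<in> S" for x
  proof (rule has_derivative_transform_within_open[of f])
    show "(f has_derivative frechet_derivative f (at x)) (at x)"
      using Suc.prems(3) x by (simp flip: frechet_derivative_works)
  qed (use Suc.prems(1,2) x in auto)
  then have eq: "frechet_derivative f (at x) = frechet_derivative g (at x)" if "x \<in> S" for x
    using that frechet_derivative_at by blast
  have "Ck_on k S (\<lambda>x. frechet_derivative g (at x) v)" for v
  proof (rule Suc.IH[OF Suc.prems(1)])
    show "Ck_on k S (\<lambda>x. frechet_derivative f (at x) v)"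
      using Suc.prems(3) by simp
  qed (simp add: eq)
  with der show ?case
    by (auto simp: differentiable_def)
qed

text \<open>The recursion in \<open>Ck_on\<close> speaks of \<open>frechet_derivative\<close>, which is chosen by Hilbert's
operator; this rule lets an explicit derivative stand in for it, so that the closure properties
below follow by induction from the usual differentiation rules.\<close>

lemma Ck_on_SucI:
  assumes "open S" "\<And>x. x \<in> S \<Longrightarrow> (f has_derivative f' x) (at x)"
    and "\<And>v. Ck_on k S (\<lambda>x. f' x v)"
  shows "Ck_on (Suc k) S f"
proof -
  have "f' x = frechet_derivative f (at x)" if "x \<in> S" for x
    using assms(2)[OF that] frechet_derivative_at by blast
  then have "Ck_on k S (\<lambda>x. frechet_derivative f (at x) v)" for v
    by (intro Ck_on_cong[OF assms(1) _ assms(3)[of v]]) auto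
  with assms(2) show ?thesis
    by (auto simp: differentiable_def)
qed

lemma Ck_on_Suc_imp_has_derivative:
  "Ck_on (Suc k) S f \<Longrightarrow> x \<in> S \<Longrightarrow> (f has_derivative frechet_derivative f (at x)) (at x)"
  by (simp flip: frechet_derivative_works)

lemma Ck_on_Suc_imp_Ck_on: "Ck_on (Suc k) S f \<Longrightarrow> Ck_on k S f"
proof (induction k arbitrary: f)
  case 0
  then show ?case
    by (auto intro!: continuous_at_imp_continuous_on differentiable_imp_continuous_within)
next
  case (Suc k)
  then show ?case by (metis Ck_on.simps(2))
qed

lemma Ck_on_mono: "Ck_on n S f \<Longrightarrow> k \<le> n \<Longrightarrow> Ck_on k S f"
  by (induction n) (auto simp: le_Suc_eq dest: Ck_on_Suc_imp_Ck_on simp del: Ck_on.simps(2))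

lemma Ck_on_imp_continuous_on: "Ck_on k S f \<Longrightarrow> continuous_on S f"
  using Ck_on_mono[of k S f 0] by simp

lemma Ck_on_const: "Ck_on k S (\<lambda>x. c)"
  by (induction k arbitrary: c) auto

lemma Ck_on_add:
  assumes "open S" "Ck_on k S f" "Ck_on k S g"
  shows "Ck_on k S (\<lambda>x. f x + g x)"
  using assms(2-3)
proof (induction k arbitrary: f g)
  case 0
  then show ?case by (auto intro: continuous_on_add)
next
  case (Suc k)
  show ?case
  proof (rule Ck_on_SucI[OF assms(1)])
    show "((\<lambda>x. f x + g x) has_derivative
        (\<lambda>v. frechet_derivative f (at x) v + frechet_derivative g (at x) v)) (at x)"
      if "x \<in> S" for x
      using Suc.prems that by (intro has_derivative_add Ck_on_Suc_imp_has_derivative)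
    show "Ck_on k S (\<lambda>x. frechet_derivative f (at x) v + frechet_derivative g (at x) v)" for v
      using Suc by simp
  qed
qed

lemma Ck_on_sum:
  assumes "open S" "finite I" "\<And>i. i \<in> I \<Longrightarrow> Ck_on k S (f i)"
  shows "Ck_on k S (\<lambda>x. \<Sum>i\<in>I. f i x)"
  using assms(2,3) by (induction I) (auto intro: Ck_on_const Ck_on_add[OF assms(1)])

lemma Ck_on_mult:
  assumes "open S" "Ck_on k S f" "Ck_on k S g"
  shows "Ck_on k S (\<lambda>x. f x * g x)"
  using assms(2-3)
proof (induction k arbitrary: f g)
  case 0
  then show ?case by (auto intro: continuous_on_mult)
next
  case (Suc k)
  show ?case
  proof (rule Ck_on_SucI[OF assms(1)])
    show "((\<lambda>x. f x * g x) has_derivative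
        (\<lambda>v. f x * frechet_derivative g (at x) v + frechet_derivative f (at x) v * g x)) (at x)"
      if "x \<in> S" for x
      using Suc.prems that by (intro has_derivative_mult Ck_on_Suc_imp_has_derivative)
    show "Ck_on k S (\<lambda>x. f x * frechet_derivative g (at x) v + frechet_derivative f (at x) v * g x)"
      for v
      using Suc.prems Suc.prems[THEN Ck_on_Suc_imp_Ck_on]
      by (intro Ck_on_add[OF assms(1)] Suc.IH) auto
  qed
qed

text \<open>By the chain rule, the derivative of \<open>g \<circ> m\<close> is a sum over the basis of products of
partial derivatives of \<open>g\<close>, taken at \<open>m x\<close>, with derivatives of the components of \<open>m\<close>. The first
factors are again compositions with \<open>m\<close>, of one order of smoothness less, whence the induction
over all \<open>g\<close> at once.\<close>

lemma Ck_on_compose: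
  fixes g :: "'b::euclidean_space \<Rightarrow> real" and m :: "'a::euclidean_space \<Rightarrow> 'b"
  assumes "open S" "open T" "Ck_on k T g" "m ` S \<subseteq> T"
    and "\<And>b. b \<in> Basis \<Longrightarrow> Ck_on k S (\<lambda>x. m x \<bullet> b)"
  shows "Ck_on k S (\<lambda>x. g (m x))"
  using assms(3,5)
proof (induction k arbitrary: g)
  case 0
  then have "continuous_on S m" 
    by (subst continuous_on_componentwise) auto
  with 0 assms(4) show ?case
    by (auto intro: continuous_on_compose2)
next
  case (Suc k)
  let ?Dm = "\<lambda>x w b. frechet_derivative (\<lambda>y. m y \<bullet> b) (at x) w"
  let ?Dg = "\<lambda>x b. frechet_derivative g (at (m x)) b"
  show ?case
  proof (rule Ck_on_SucI[OF assms(1)])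
    fix x assume x: "x \<in> S"
    have Dm: "(m has_derivative (\<lambda>w. \<Sum>b\<in>Basis. ?Dm x w b *\<^sub>R b)) (at x)"
      unfolding has_derivative_componentwise_within[of m]
      using Ck_on_Suc_imp_has_derivative[OF Suc.prems(2) x] by simp
    have Dg: "(g has_derivative ?Dg x) (at (m x))"
      using Ck_on_Suc_imp_has_derivative[OF Suc.prems(1), of "m x"] x assms(4) by auto
    have "?Dg x (\<Sum>b\<in>Basis. ?Dm x w b *\<^sub>R b) = (\<Sum>b\<in>Basis. ?Dm x w b * ?Dg x b)" for w
      using has_derivative_linear[OF Dg] by (simp add: linear_sum linear_scale)
    then show "((\<lambda>x. g (m x)) has_derivative (\<lambda>w. \<Sum>b\<in>Basis. ?Dm x w b * ?Dg x b)) (at x)"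
      using diff_chain_at[OF Dm Dg] by (simp add: o_def)
  next
    fix w
    have "Ck_on k S (\<lambda>x. ?Dg x b)" if "b \<in> Basis" for b
      using Suc.prems by (intro Suc.IH[of "\<lambda>y. frechet_derivative g (at y) b"])
        (auto dest: Ck_on_Suc_imp_Ck_on simp del: Ck_on.simps(2) simp: Ck_on.simps(2)[of k T g])
    then show "Ck_on k S (\<lambda>x. \<Sum>b\<in>Basis. ?Dm x w b * ?Dg x b)"
      using Suc.prems(2) assms(1) by (intro Ck_on_sum Ck_on_mult) auto
  qed
qed

lemma Ck_on_affine:
  fixes l :: "'a::euclidean_space \<Rightarrow> real"
  assumes "bounded_linear l" "open S"
  shows "Ck_on k S (\<lambda>x. c + l x)"
proof (cases k)
  case 0
  then show ?thesis
    using assms(1) by (auto intro!: continuous_intros simp: linear_continuous_on)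
next
  case (Suc n)
  have "((\<lambda>x. c + l x) has_derivative l) (at x)" for x
    using has_derivative_add[OF has_derivative_const bounded_linear_imp_has_derivative[OF assms(1)]]
    by simp
  then show ?thesis
    unfolding Suc by (intro Ck_on_SucI[OF assms(2), of _ "\<lambda>_. l"] Ck_on_const) auto
qed

section \<open>Iterated directional derivatives\<close>

definition dir_deriv :: "'a::real_normed_vector \<Rightarrow> ('a \<Rightarrow> real) \<Rightarrow> 'a \<Rightarrow> real" where
  "dir_deriv v f = (\<lambda>x. frechet_derivative f (at x) v)"

lemma Ck_on_dir_deriv: "Ck_on (Suc k) S f \<Longrightarrow> Ck_on k S (dir_deriv v f)"
  by (simp add: dir_deriv_def)

lemma Ck_on_iterated_dir_deriv:
  "Ck_on (m + k) S f \<Longrightarrow> Ck_on k S ((dir_deriv v ^^ m) f)"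
proof (induction m arbitrary: k)
  case (Suc m)
  then have "Ck_on (Suc k) S ((dir_deriv v ^^ m) f)"
    by (simp del: Ck_on.simps(2))
  then show ?case using Ck_on_dir_deriv by simp
qed simp

lemma dir_deriv_lincomb:
  assumes "Ck_on (Suc k) UNIV f" "Ck_on (Suc k) UNIV g"
  shows "dir_deriv v (\<lambda>x. s * f x + t * g x) = (\<lambda>x. s * dir_deriv v f x + t * dir_deriv v g x)"
proof
  fix x
  have "((\<lambda>x. s * f x + t * g x) has_derivative
      (\<lambda>w. s * frechet_derivative f (at x) w + t * frechet_derivative g (at x) w)) (at x)"
    by (intro has_derivative_add has_derivative_mult_right
        Ck_on_Suc_imp_has_derivative[OF assms(1)] Ck_on_Suc_imp_has_derivative[OF assms(2)]) auto
  from frechet_derivative_at[OF this, symmetric]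
  show "dir_deriv v (\<lambda>x. s * f x + t * g x) x = s * dir_deriv v f x + t * dir_deriv v g x"
    by (simp add: dir_deriv_def fun_eq_iff)
qed

lemma dir_deriv_Pair:
  fixes f :: "real \<times> real \<Rightarrow> real"
  assumes "Ck_on (Suc k) UNIV f"
  shows "dir_deriv (s, t) f = (\<lambda>x. s * dir_deriv (1, 0) f x + t * dir_deriv (0, 1) f x)"
proof
  fix x
  have lin: "linear (frechet_derivative f (at x))"
    using Ck_on_Suc_imp_has_derivative[OF assms UNIV_I] by (rule has_derivative_linear)
  have "frechet_derivative f (at x) (s *\<^sub>R (1, 0) + t *\<^sub>R (0, 1))
      = s * frechet_derivative f (at x) (1, 0) + t * frechet_derivative f (at x) (0, 1)"
    unfolding linear_add[OF lin] linear_scale[OF lin] by simp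
  then show "dir_deriv (s, t) f x = s * dir_deriv (1, 0) f x + t * dir_deriv (0, 1) f x"
    by (simp add: dir_deriv_def)
qed

lemma dir_deriv_swap:
  fixes f :: "real \<times> real \<Rightarrow> real"
  assumes "Ck_on (Suc k) UNIV f"
  shows "dir_deriv v (\<lambda>x. f (prod.swap x)) = (\<lambda>x. dir_deriv (prod.swap v) f (prod.swap x))"
proof
  fix x
  have "((\<lambda>z::real \<times> real. (snd z, fst z)) has_derivative (\<lambda>z. (snd z, fst z))) (at x)"
    by (auto intro!: derivative_eq_intros)
  then have "(prod.swap has_derivative (prod.swap :: real \<times> real \<Rightarrow> _)) (at x)"
    by (simp add: prod.swap_def[abs_def])
  from diff_chain_at[OF this Ck_on_Suc_imp_has_derivative[OF assms UNIV_I]]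
  have "((\<lambda>x. f (prod.swap x)) has_derivative
      (\<lambda>w. frechet_derivative f (at (prod.swap x)) (prod.swap w))) (at x)"
    by (simp add: o_def)
  from frechet_derivative_at[OF this, symmetric]
  show "dir_deriv v (\<lambda>x. f (prod.swap x)) x = dir_deriv (prod.swap v) f (prod.swap x)"
    by (simp add: dir_deriv_def)
qed

lemma DERIV_along_line:
  assumes "Ck_on (Suc k) UNIV f"
  shows "((\<lambda>\<tau>. f (\<tau> *\<^sub>R v)) has_real_derivative dir_deriv v f (\<tau> *\<^sub>R v)) (at \<tau>)"
proof -
  have *: "((\<lambda>\<tau>. \<tau> *\<^sub>R v) has_derivative (\<lambda>r. r *\<^sub>R v)) (at \<tau>)"
    by (auto intro!: derivative_eq_intros)
  from diff_chain_at[OF this Ck_on_Suc_imp_has_derivative[OF assms UNIV_I]]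
  have "((\<lambda>\<tau>. f (\<tau> *\<^sub>R v)) has_derivative
      (\<lambda>r. frechet_derivative f (at (\<tau> *\<^sub>R v)) (r *\<^sub>R v))) (at \<tau>)"
    by (simp add: o_def)
  moreover have "linear (frechet_derivative f (at (\<tau> *\<^sub>R v)))"
    using Ck_on_Suc_imp_has_derivative[OF assms UNIV_I] by (rule has_derivative_linear)
  ultimately show ?thesis
    by (simp add: has_field_derivative_def dir_deriv_def linear_scale mult.commute[of _ "frechet_derivative _ _ _"])
qed

lemma DERIV_iterated_along_line:
  assumes "Ck_on n UNIV f" "m < n"
  shows "((\<lambda>\<tau>. (dir_deriv v ^^ m) f (\<tau> *\<^sub>R v)) has_real_derivative
    (dir_deriv v ^^ Suc m) f (\<tau> *\<^sub>R v)) (at \<tau>)"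
proof -
  have "Ck_on (Suc 0) UNIV ((dir_deriv v ^^ m) f)"
    using assms by (intro Ck_on_iterated_dir_deriv Ck_on_mono[OF assms(1)]) simp
  from DERIV_along_line[OF this] show ?thesis by simp
qed

text \<open>By linearity in each direction, the \<open>k\<close>-th derivative along \<open>(s, t)\<close> is a sum over all words
of length \<open>k\<close> in the two coordinate directions. Symmetry of \<open>Q\<close> says that at the origin a word
and the word with the two directions exchanged give the same value. Hence
\<open>s\<^sup>i t\<^sup>j\<close> and \<open>s\<^sup>j t\<^sup>i\<close> get the same coefficient, the sum over all words with \<open>i\<close> letters of one
kind and \<open>j\<close> of the other.\<close>

lemma symmetric_dir_derivs:
  fixes Q :: "real \<times> real \<Rightarrow> real"
  assumes Q: "Ck_on 3 UNIV Q" and sym: "\<And>x. Q (prod.swap x) = Q x"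
  obtains c1 c2 d2 c3 d3 where
    "\<And>s t. (dir_deriv (s, t) ^^ 1) Q 0 = (s + t) * c1"
    "\<And>s t. (dir_deriv (s, t) ^^ 2) Q 0 = (s\<^sup>2 + t\<^sup>2) * c2 + s * t * d2"
    "\<And>s t. (dir_deriv (s, t) ^^ 3) Q 0 = (s ^ 3 + t ^ 3) * c3 + (s\<^sup>2 * t + s * t\<^sup>2) * d3"
proof -
  let ?D = "dir_deriv :: real \<times> real \<Rightarrow> (real \<times> real \<Rightarrow> real) \<Rightarrow> real \<times> real \<Rightarrow> real"
  let ?u = "(1, 0) :: real \<times> real" and ?v = "(0, 1) :: real \<times> real"
  have Q3: "Ck_on (Suc (Suc (Suc 0))) UNIV Q"
    using Q by (simp only: numeral_3_eq_3)
  have Q2: "Ck_on (Suc (Suc 0)) UNIV (?D v Q)" for v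
    using Q3 by (rule Ck_on_dir_deriv)
  have Q1: "Ck_on (Suc 0) UNIV (?D v (?D w Q))" for v w
    using Q2 by (rule Ck_on_dir_deriv)
  \<comment> \<open>Exchanging the directions: each step applies \<open>dir_deriv_swap\<close> to the previous identity.\<close>
  have sw1: "?D v Q = (\<lambda>x. ?D (prod.swap v) Q (prod.swap x))" for v
    using dir_deriv_swap[OF Q3, of v] by (simp add: sym)
  have sw2: "?D v (?D w Q) = (\<lambda>x. ?D (prod.swap v) (?D (prod.swap w) Q) (prod.swap x))" for v w
    using dir_deriv_swap[OF Q2, of v "prod.swap w"] by (simp flip: sw1)
  have sw3: "?D z (?D v (?D w Q)) =
      (\<lambda>x. ?D (prod.swap z) (?D (prod.swap v) (?D (prod.swap w) Q)) (prod.swap x))" for z v w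
    using dir_deriv_swap[OF Q1, of z "prod.swap v" "prod.swap w"] by (simp flip: sw2)
  have swap0: "prod.swap (0 :: real \<times> real) = 0"
    by (simp add: zero_prod_def)
  \<comment> \<open>Linearity in the outermost direction (\<open>e1\<close> to \<open>e3\<close>), then in the inner ones.\<close>
  have e1: "?D (s, t) Q = (\<lambda>x. s * ?D ?u Q x + t * ?D ?v Q x)" for s t
    by (rule dir_deriv_Pair[OF Q3])
  have e2: "?D (s, t) (?D w Q) = (\<lambda>x. s * ?D ?u (?D w Q) x + t * ?D ?v (?D w Q) x)" for s t w
    by (rule dir_deriv_Pair[OF Q2])
  have e3: "?D (s, t) (?D z (?D w Q)) =
      (\<lambda>x. s * ?D ?u (?D z (?D w Q)) x + t * ?D ?v (?D z (?D w Q)) x)" for s t w z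
    by (rule dir_deriv_Pair[OF Q1])
  have f2: "?D z (?D (s, t) Q) = (\<lambda>x. s * ?D z (?D ?u Q) x + t * ?D z (?D ?v Q) x)" for s t z
    unfolding e1[of s t] by (rule dir_deriv_lincomb[OF Q2 Q2])
  have f3: "?D y (?D z (?D (s, t) Q)) =
      (\<lambda>x. s * ?D y (?D z (?D ?u Q)) x + t * ?D y (?D z (?D ?v Q)) x)" for s t z y
    unfolding f2[of z s t] by (rule dir_deriv_lincomb[OF Q1 Q1])
  have g3: "?D y (?D (s, t) (?D w Q)) =
      (\<lambda>x. s * ?D y (?D ?u (?D w Q)) x + t * ?D y (?D ?v (?D w Q)) x)" for s t w y
    unfolding e2[of s t w] by (rule dir_deriv_lincomb[OF Q1 Q1])
  have s1: "?D ?v Q 0 = ?D ?u Q 0"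
    using sw1[of ?v] by (simp add: swap0)
  have s2: "?D ?v (?D ?v Q) 0 = ?D ?u (?D ?u Q) 0" 
    using sw2[of ?v ?v] by (simp add: swap0)
  have s3: "?D ?v (?D ?v (?D ?v Q)) 0 = ?D ?u (?D ?u (?D ?u Q)) 0"
     "?D ?v (?D ?v (?D ?u Q)) 0 = ?D ?u (?D ?u (?D ?v Q)) 0"
     "?D ?v (?D ?u (?D ?v Q)) 0 = ?D ?u (?D ?v (?D ?u Q)) 0"
     "?D ?u (?D ?v (?D ?v Q)) 0 = ?D ?v (?D ?u (?D ?u Q)) 0"
    using sw3[of ?v ?v ?v] sw3[of ?v ?v ?u] sw3[of ?v ?u ?v] sw3[of ?u ?v ?v]
    by (simp_all add: swap0)
  show thesis
  proof
    show "(?D (s, t) ^^ 1) Q 0 = (s + t) * ?D ?u Q 0" for s t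
      using e1[of s t] s1 by (simp add: algebra_simps)
    have "(?D (s, t) ^^ 2) Q 0 = s * (s * ?D ?u (?D ?u Q) 0 + t * ?D ?u (?D ?v Q) 0)
        + t * (s * ?D ?v (?D ?u Q) 0 + t * ?D ?v (?D ?v Q) 0)" for s t
      by (simp only: numeral_2_eq_2 funpow.simps o_apply id_apply e2[of s t "(s, t)"]
          f2[of ?u s t] f2[of ?v s t])
    then show "(?D (s, t) ^^ 2) Q 0 = (s\<^sup>2 + t\<^sup>2) * ?D ?u (?D ?u Q) 0
        + s * t * (?D ?u (?D ?v Q) 0 + ?D ?v (?D ?u Q) 0)" for s t
      using s2 by (simp add: algebra_simps power2_eq_square)
    have "(?D (s, t) ^^ 3) Q 0 =
          s * (s * (s * ?D ?u (?D ?u (?D ?u Q)) 0 + t * ?D ?u (?D ?u (?D ?v Q)) 0)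
            + t * (s * ?D ?u (?D ?v (?D ?u Q)) 0 + t * ?D ?u (?D ?v (?D ?v Q)) 0))
        + t * (s * (s * ?D ?v (?D ?u (?D ?u Q)) 0 + t * ?D ?v (?D ?u (?D ?v Q)) 0)
            + t * (s * ?D ?v (?D ?v (?D ?u Q)) 0 + t * ?D ?v (?D ?v (?D ?v Q)) 0))" for s t
      by (simp only: numeral_3_eq_3 funpow.simps o_apply id_apply e3[of s t "(s, t)" "(s, t)"]
          g3[of ?u s t "(s, t)"] g3[of ?v s t "(s, t)"]
          f3[of ?u ?u s t] f3[of ?u ?v s t] f3[of ?v ?u s t] f3[of ?v ?v s t])
    then show "(?D (s, t) ^^ 3) Q 0 = (s ^ 3 + t ^ 3) * ?D ?u (?D ?u (?D ?u Q)) 0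
        + (s\<^sup>2 * t + s * t\<^sup>2) *
          (?D ?u (?D ?u (?D ?v Q)) 0 + ?D ?u (?D ?v (?D ?u Q)) 0 + ?D ?v (?D ?u (?D ?u Q)) 0)"
      for s t
      using s3 by (simp add: algebra_simps power2_eq_square power3_eq_cube)
  qed
qed

section \<open>Expansion of the error\<close>

text \<open>The Lagrange form of the remainder differs from the last Taylor term only in the point at
which the highest derivative is taken, so continuity of that derivative at \<open>0\<close> is enough.\<close>

lemma taylor_peano:
  fixes d :: "nat \<Rightarrow> real \<Rightarrow> real"
  assumes n: "n > 0"
    and d: "\<And>m t. m < n \<Longrightarrow> (d m has_real_derivative d (Suc m) t) (at t)"
    and cont: "isCont (d n) 0"
  shows "(\<lambda>h. d 0 h - (\<Sum>k\<le>n. d k 0 / fact k * h ^ k)) \<in> o[at_right 0](\<lambda>h. h ^ n)"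
proof (rule landau_o.smallI)
  fix c :: real assume c: "c > 0"
  have "\<forall>\<^sub>F t in at 0. dist (d n t) (d n 0) < c"
    using cont c by (simp add: isCont_def tendsto_iff)
  then obtain \<delta> where \<delta>: "\<delta> > 0" "\<And>t. t \<noteq> 0 \<Longrightarrow> dist t 0 < \<delta> \<Longrightarrow> dist (d n t) (d n 0) < c"
    unfolding eventually_at by auto
  have "norm (d 0 h - (\<Sum>k\<le>n. d k 0 / fact k * h ^ k)) \<le> c * norm (h ^ n)"
    if h: "0 < h" "h < \<delta>" for h
  proof -
    obtain t where t: "0 < t" "t < h"
      "d 0 h = (\<Sum>m<n. d m 0 / fact m * h ^ m) + d n t / fact n * h ^ n"
      using Maclaurin[of h n d "d 0"] h n d by blast
    have "d 0 h - (\<Sum>k\<le>n. d k 0 / fact k * h ^ k) = (d n t - d n 0) / fact n * h ^ n"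
      unfolding t(3) lessThan_Suc_atMost[symmetric] by (simp add: field_simps)
    also have "norm \<dots> = \<bar>d n t - d n 0\<bar> / fact n * norm (h ^ n)"
      by (simp add: abs_mult)
    also have "\<bar>d n t - d n 0\<bar> / fact n \<le> c / 1"
      using \<delta>(2)[of t] t h c by (intro frac_le) (auto simp: dist_real_def fact_ge_1)
    finally show ?thesis
      by (simp add: mult_right_mono)
  qed
  then show "\<forall>\<^sub>F h in at_right 0. norm (d 0 h - (\<Sum>k\<le>n. d k 0 / fact k * h ^ k)) \<le> c * norm (h ^ n)"
    unfolding eventually_at_right_field using \<delta>(1) by auto
qed

lemma taylor_along_line:
  assumes "Ck_on n UNIV Q" "n > 0"
  shows "(\<lambda>h. Q (h *\<^sub>R v) - (\<Sum>k\<le>n. (dir_deriv v ^^ k) Q 0 / fact k * h ^ k))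
    \<in> o[at_right 0](\<lambda>h. h ^ n)"
proof -
  have "continuous_on UNIV ((dir_deriv v ^^ n) Q)"
    using Ck_on_iterated_dir_deriv[of n 0 UNIV Q v] assms(1) by simp
  then have "continuous_on UNIV (\<lambda>\<tau>. (dir_deriv v ^^ n) Q (\<tau> *\<^sub>R v))"
    by (rule continuous_on_compose2) (auto intro!: continuous_intros)
  then have "isCont (\<lambda>\<tau>. (dir_deriv v ^^ n) Q (\<tau> *\<^sub>R v)) 0"
    by (simp add: continuous_on_eq_continuous_at)
  from taylor_peano[OF assms(2) DERIV_iterated_along_line[OF assms(1)] this]
  show ?thesis by simp
qed

text \<open>The primitive \<open>G\<close> is the zeroth term of the chain of derivatives, so the \<open>n\<close>
derivatives of \<open>Q\<close> along the line give one order more for \<open>G\<close>.\<close>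

lemma taylor_integral_along_line:
  assumes Q: "Ck_on n UNIV Q"
    and G: "\<And>t. (G has_real_derivative Q (t *\<^sub>R v)) (at t)"
  shows "(\<lambda>h. G h - G 0 - (\<Sum>k\<le>n. (dir_deriv v ^^ k) Q 0 / fact (Suc k) * h ^ Suc k))
    \<in> o[at_right 0](\<lambda>h. h ^ Suc n)"
proof -
  define d where "d m = (case m of 0 \<Rightarrow> G | Suc m \<Rightarrow> (\<lambda>\<tau>. (dir_deriv v ^^ m) Q (\<tau> *\<^sub>R v)))" for m
  have der: "(d m has_real_derivative d (Suc m) t) (at t)" if "m < Suc n" for m t
    using G DERIV_iterated_along_line[OF Q, of "m - 1"] that
    by (cases m) (auto simp: d_def)
  have "continuous_on UNIV ((dir_deriv v ^^ n) Q)"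
    using Ck_on_iterated_dir_deriv[of n 0 UNIV Q v] Q by simp
  then have "continuous_on UNIV (\<lambda>\<tau>. (dir_deriv v ^^ n) Q (\<tau> *\<^sub>R v))"
    by (rule continuous_on_compose2) (auto intro!: continuous_intros)
  then have "isCont (d (Suc n)) 0"
    by (simp add: continuous_on_eq_continuous_at d_def)
  from taylor_peano[of "Suc n" d, OF _ der this] show ?thesis
    by (simp add: d_def sum.atMost_Suc_shift diff_diff_eq del: sum.atMost_Suc)
qed

text \<open>The terms up to \<open>h\<^sup>4\<close> cancel, since the three-point rule
integrates the restriction to the diagonal of a symmetric cubic polynomial exactly: the values of
such a polynomial at \<open>(0, 1/2)\<close>, \<open>(1/2, 1)\<close>, \<open>(0, 1)\<close> with weights \<open>2/3\<close>, \<open>2/3\<close>, \<open>-1/3\<close>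
reproduce its mean along the diagonal.\<close>

lemma richardson_error:
  fixes Q :: "real \<times> real \<Rightarrow> real"
  assumes Q: "Ck_on 3 UNIV Q" and sym: "\<And>x. Q (prod.swap x) = Q x"
    and G: "\<And>t. (G has_real_derivative Q (t, t)) (at t)"
  shows "(\<lambda>h. h * (2/3 * (Q (0, h/2) + Q (h/2, h)) - 1/3 * Q (0, h)) - (G h - G 0))
    \<in> o[at_right 0](\<lambda>h. h ^ 4)"
proof -
  define p where "p v k = (dir_deriv v ^^ k) Q 0" for v k
  define E where "E v h = Q (h *\<^sub>R v) - (\<Sum>k\<le>3. p v k / fact k * h ^ k)" for v h
  define EG where "EG h = G h - G 0 - (\<Sum>k\<le>3. p (1, 1) k / fact (Suc k) * h ^ Suc k)" for h
  have E: "(\<lambda>h. h * E v h) \<in> o[at_right 0](\<lambda>h. h ^ 4)" for v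
    using landau_o.small.mult_left[OF taylor_along_line[OF Q, of v], of "\<lambda>h. h"]
    by (simp add: E_def p_def flip: power_Suc)
  have EG: "EG \<in> o[at_right 0](\<lambda>h. h ^ 4)"
    using taylor_integral_along_line[OF Q, of G "(1, 1)"] G
    unfolding EG_def p_def by simp
  obtain c1 c2 d2 c3 d3 where
    p1: "\<And>s t. p (s, t) 1 = (s + t) * c1" and
    p2: "\<And>s t. p (s, t) 2 = (s\<^sup>2 + t\<^sup>2) * c2 + s * t * d2" and
    p3: "\<And>s t. p (s, t) 3 = (s ^ 3 + t ^ 3) * c3 + (s\<^sup>2 * t + s * t\<^sup>2) * d3"
    using symmetric_dir_derivs[OF Q sym] unfolding p_def by metis
  have p0: "p v 0 = Q 0" for v
    by (simp add: p_def)
  have sum3: "(\<Sum>k\<le>3. F k) = F 0 + F 1 + F 2 + F 3" for F :: "nat \<Rightarrow> real"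
    by (simp add: eval_nat_numeral)
  have QE: "Q (h * s, h * t) = E (s, t) h + (Q 0 + (s + t) * c1 * h
      + ((s\<^sup>2 + t\<^sup>2) * c2 + s * t * d2) / 2 * h\<^sup>2
      + ((s ^ 3 + t ^ 3) * c3 + (s\<^sup>2 * t + s * t\<^sup>2) * d3) / 6 * h ^ 3)" for s t h
    unfolding E_def sum3 p0 p1 p2 p3 by (simp add: fact_numeral)
  have EG_eq: "G h - G 0 = EG h + (Q 0 * h + c1 * h\<^sup>2 + (2 * c2 + d2) / 6 * h ^ 3
      + (c3 + d3) / 12 * h ^ 4)" for h
    unfolding EG_def sum3 p0 p1 p2 p3
    by (simp add: fact_numeral field_simps eval_nat_numeral)
  have "h * (2/3 * (Q (0, h/2) + Q (h/2, h)) - 1/3 * Q (0, h)) - (G h - G 0)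
      = 2/3 * (h * E (0, 1/2) h) + 2/3 * (h * E (1/2, 1) h) - 1/3 * (h * E (0, 1) h) - EG h" for h
  proof -
    have 1: "Q (0, h/2) = E (0, 1/2) h
        + (Q 0 + c1 / 2 * h + c2 / 8 * h\<^sup>2 + c3 / 48 * h ^ 3)"
      using QE[of h 0 "1/2"] by (simp add: field_simps power2_eq_square power3_eq_cube)
    have 2: "Q (h/2, h) = E (1/2, 1) h
        + (Q 0 + 3/2 * c1 * h + (5/8 * c2 + d2 / 4) * h\<^sup>2 + (3/16 * c3 + d3 / 8) * h ^ 3)"
      using QE[of h "1/2" 1] by (simp add: field_simps power2_eq_square power3_eq_cube)
    have 3: "Q (0, h) = E (0, 1) h + (Q 0 + c1 * h + c2 / 2 * h\<^sup>2 + c3 / 6 * h ^ 3)"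
      using QE[of h 0 1] by (simp add: field_simps)
    show ?thesis
      unfolding 1 2 3 EG_eq by (simp add: field_simps eval_nat_numeral)
  qed
  then show ?thesis
    using E EG by (auto intro!: sum_in_smallo)
qed


theorem mainTheorem3:
  fixes R :: "real set" and fs :: "real \<Rightarrow> real" and q1 q2 :: "real list \<Rightarrow> real"
  assumes fs_C4: "Ck_on 4 UNIV fs"
    and fs_bij: "bij_betw fs UNIV R"
    and q1_C3: "Ck_on 3 (R \<times> R) (\<lambda>(u, v). q1 [u, v])"
    and q1_sym: "symmetric_quadrature R [0, 1] q1"
    and q1_exact: "affinely_exact [0, 1] q1 fs"
    and q2_eq: "\<And>f0 f1 f2. f0 \<in> R \<Longrightarrow> f1 \<in> R \<Longrightarrow> f2 \<in> R \<Longrightarrow>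
      q2 [f0, f1, f2] = 2/3 * (q1 [f0, f1] + q1 [f1, f2]) - 1/3 * q1 [f0, f2]"
  shows "symmetric_quadrature R [0, 1/2, 1] q2 \<and>
    affinely_exact [0, 1/2, 1] q2 fs \<and>
    (\<forall>f a. Ck_on 4 UNIV f \<and> range f \<subseteq> R \<longrightarrow>
      (\<lambda>h. \<bar>quadrature [0, 1/2, 1] q2 a h f - integral {a..a + h} f\<bar>)
        \<in> o[at_right 0](\<lambda>h. h ^ 4))"
proof (intro conjI allI impI)
  have fs_R: "fs x \<in> R" for x
    using fs_bij by (auto simp: bij_betw_def)
  have sym1: "q1 [v, u] = q1 [u, v]" if "u \<in> R" "v \<in> R" for u v
    using q1_sym that unfolding symmetric_quadrature_def
    by (auto dest!: spec[of _ "[u, v]"])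
  show "symmetric_quadrature R [0, 1/2, 1] q2"
    unfolding symmetric_quadrature_def
  proof (intro conjI allI impI)
    fix k :: nat assume "k < length [0, 1/2, 1::real]"
    then have "k \<in> {0, 1, 2}" by auto
    then show "[0, 1/2, 1::real] ! (length [0, 1/2, 1::real] - 1 - k) = 1 - [0, 1/2, 1] ! k"
      by auto
  next
    fix ys :: "real list" assume "length ys = length [0, 1/2, 1::real] \<and> set ys \<subseteq> R"
    then obtain u v w where "ys = [u, v, w]" "u \<in> R" "v \<in> R" "w \<in> R"
      by (auto simp: length_Suc_conv)
    then show "q2 (rev ys) = q2 ys"
      using sym1 by (simp add: q2_eq)
  qed
  have exact1: "((\<lambda>x. fs (\<alpha> * x + \<beta>)) has_integral
      h * q1 [fs (\<alpha> * a + \<beta>), fs (\<alpha> * (a + h) + \<beta>)]) {a..a + h}" if "h > 0" for \<alpha> \<beta> a h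
    using q1_exact that unfolding affinely_exact_def quadrature_def by simp
  show "affinely_exact [0, 1/2, 1] q2 fs"
    unfolding affinely_exact_def
  proof (intro allI impI)
    fix \<alpha> \<beta> a h :: real assume h: "h > 0"
    let ?g = "\<lambda>x. fs (\<alpha> * x + \<beta>)"
    let ?I = "h * q1 [?g a, ?g (a + h)]"
    let ?J1 = "h/2 * q1 [?g a, ?g (a + h/2)]" and ?J2 = "h/2 * q1 [?g (a + h/2), ?g (a + h)]"
    have I: "(?g has_integral ?I) {a..a + h}"
      using exact1 h by blast
    have mid: "a + h/2 + h/2 = a + h"
      by simp
    have "(?g has_integral ?J1) {a..a + h/2}"
      using exact1[of "h/2" \<alpha> \<beta> a] h by simp
    moreover have "(?g has_integral ?J2) {a + h/2..a + h}"
      using exact1[of "h/2" \<alpha> \<beta> "a + h/2", unfolded mid] h by simp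
    ultimately have "(?g has_integral ?J1 + ?J2) {a..a + h}"
      using h by (intro has_integral_combine[of a "a + h/2"]) auto
    with I have "?J1 + ?J2 = ?I"
      by (rule has_integral_unique[symmetric])
    then have "quadrature [0, 1/2, 1] q2 a h ?g = ?I"
      by (simp add: quadrature_def q2_eq fs_R algebra_simps)
    with I show "(?g has_integral quadrature [0, 1/2, 1] q2 a h ?g) {a..a + h}"
      by simp
  qed
  fix f :: "real \<Rightarrow> real" and a :: real assume f: "Ck_on 4 UNIV f \<and> range f \<subseteq> R"
  then have f_R: "f x \<in> R" for x by auto
  \<comment> \<open>Exactness for the slope \<open>\<alpha> = 0\<close> is exactness on the constants in \<open>R\<close>.\<close>
  have q1_diag: "q1 [u, u] = u" if u: "u \<in> R" for u
  proof -
    obtain x where x: "u = fs x"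
      using fs_bij u by (auto simp: bij_betw_def)
    have "((\<lambda>_::real. u) has_integral q1 [u, u]) {0..1}"
      using exact1[of 1 0 x 0] x by simp
    moreover have "((\<lambda>_::real. u) has_integral u) {0..1}"
      using has_integral_const_real[of u 0 1] by simp
    ultimately show ?thesis by (rule has_integral_unique)
  qed
  \<comment> \<open>Openness makes the derivatives of \<open>q1\<close> on \<open>R \<times> R\<close> available to the chain rule.\<close>
  have "open R"
  proof -
    have "open (fs ` UNIV)"
      using fs_bij Ck_on_imp_continuous_on[OF fs_C4]
      by (intro injective_into_1d_imp_open_map_UNIV[of UNIV UNIV]) (auto simp: bij_betw_def)
    then show ?thesis
      using fs_bij by (simp add: bij_betw_def)
  qed
  define Q where "Q = (\<lambda>(x, y). q1 [f (a + x), f (a + y)])"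
  have f_shift: "Ck_on 3 UNIV (\<lambda>p. f (a + l p))" if "bounded_linear l"
    for l :: "real \<times> real \<Rightarrow> real"
  proof (rule Ck_on_compose[of UNIV UNIV _ f "\<lambda>p. a + l p"])
    show "Ck_on 3 UNIV f"
      using f by (auto intro: Ck_on_mono)
    show "Ck_on 3 UNIV (\<lambda>p. (a + l p) \<bullet> b)" if "b \<in> Basis" for b :: real
      using that Ck_on_affine[OF \<open>bounded_linear l\<close> open_UNIV] by simp
  qed auto
  have "Ck_on 3 UNIV (\<lambda>p. (\<lambda>(u, v). q1 [u, v]) (f (a + fst p), f (a + snd p)))"
  proof (rule Ck_on_compose[OF open_UNIV _ q1_C3])
    show "open (R \<times> R)"
      using \<open>open R\<close> by (simp add: open_Times)
    show "(\<lambda>p. (f (a + fst p), f (a + snd p))) ` UNIV \<subseteq> R \<times> R"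
      using f_R by auto
    show "Ck_on 3 UNIV (\<lambda>p. (f (a + fst p), f (a + snd p)) \<bullet> b)" if "b \<in> Basis" for b
      using that f_shift[OF bounded_linear_fst] f_shift[OF bounded_linear_snd]
      by (auto simp: Basis_prod_def)
  qed
  then have Q_C3: "Ck_on 3 UNIV Q"
    by (simp add: Q_def case_prod_unfold)
  have Q_sym: "Q (prod.swap x) = Q x" for x
    using sym1 f_R by (cases x) (simp add: Q_def)
  have f_cont: "isCont f x" for x
    using f Ck_on_imp_continuous_on[of 4 UNIV f] by (simp add: continuous_on_eq_continuous_at)
  then obtain F where F: "\<And>x. (F has_vector_derivative f x) (at x)"
    using einterval_antiderivative[of "-\<infinity>" \<infinity> f] by auto
  define G where "G t = F (a + t)" for t
  have "(G has_real_derivative Q (t, t)) (at t)" for t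
  proof -
    have "(F has_real_derivative f (a + t)) (at (a + t))"
      using F by (simp add: has_real_derivative_iff_has_vector_derivative)
    then have "(G has_real_derivative f (a + t)) (at t)"
      unfolding G_def using DERIV_at_within_shift[of F "f (a + t)" a t UNIV] by simp
    then show ?thesis
      by (simp add: Q_def q1_diag f_R)
  qed
  from richardson_error[OF Q_C3 Q_sym this]
  have *: "(\<lambda>h. h * (2/3 * (Q (0, h/2) + Q (h/2, h)) - 1/3 * Q (0, h)) - (G h - G 0))
    \<in> o[at_right 0](\<lambda>h. h ^ 4)" .
  have "quadrature [0, 1/2, 1] q2 a h f - integral {a..a + h} f
      = h * (2/3 * (Q (0, h/2) + Q (h/2, h)) - 1/3 * Q (0, h)) - (G h - G 0)" if "h > 0" for h
  proof -
    have "(f has_integral F (a + h) - F a) {a..a + h}"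
      using that F by (intro fundamental_theorem_of_calculus)
        (auto intro: has_vector_derivative_at_within)
    then have "integral {a..a + h} f = G h - G 0"
      by (simp add: G_def integral_unique)
    then show ?thesis
      by (simp add: quadrature_def q2_eq f_R Q_def)
  qed
  then have "\<forall>\<^sub>F h in at_right 0. h * (2/3 * (Q (0, h/2) + Q (h/2, h)) - 1/3 * Q (0, h)) - (G h - G 0)
      = quadrature [0, 1/2, 1] q2 a h f - integral {a..a + h} f"
    by (auto simp: eventually_at_filter)
  from landau_o.small.in_cong[OF this] *
  show "(\<lambda>h. \<bar>quadrature [0, 1/2, 1] q2 a h f - integral {a..a + h} f\<bar>)
      \<in> o[at_right 0](\<lambda>h. h ^ 4)"
    by simp
qed

end
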